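(* Let $X=Y$ be a locally compact complete geodesic space with metric $d$, and let $c\colon X^2\to\mathbb{R}_+$ be of the form $c(x,y)=h\big(d(x,y)\big)$, where $h\colon\mathbb{R}_+\to\mathbb{R}_+$ is locally Lipschitz with $\lim_{a\to\infty}h'(a)=\infty$ whenever $h'$ exists (i.e., the limit is taken along those $a$ at which $h$ is differentiable). Then, for any $\mu,\nu\in\mathcal{P}(X)$ with $T_c(\mu,\nu)<\infty$ and any optimal transport plan $\pi\in\mathcal{C}(\mu,\nu)$, $$\Sigma_\pi\subset\partial\,\mathrm{supp}\,\mu .$$
   Context: $\mathcal{P}(X)$ is the set of Borel probability measures; $\mathcal{C}(\mu,\nu)$ is the set of probability measures on $X\times Y$ with marginals $\mu,\nu$; $T_c(\mu,\nu)=\inf_{\pi\in\mathcal{C}(\mu,\nu)}\int c\,\mathrm{d}\pi$, and $\pi$ is optimal if it attains the infimum. $\mathrm{supp}$ is the smallest closed set of full measure, $\partial A=\mathrm{cl}(A)\setminus\mathrm{int}(A)$, and $p_X\colon X\times Y\to X$ is the projection (onto the first component). A geodesic space is a metric space in which any two points $x',x''$ are joined by a geodesic $\gamma\colon[0,d(x',x'')]\to X$ (an isometric embedding with endpoints $x',x''$). A plan $\pi\in\mathcal{C}(\mu,\nu)$ induces regularity on a relatively open set $U\subset\mathrm{supp}\,\mu$ if there is a compact $K\subset\mathrm{supp}\,\nu$ with $p_X(\mathrm{supp}\,\pi)\cap U=p_X\big(\mathrm{supp}\,\pi\cap(U\times K)\big)$. It induces regularity at $x\in\mathrm{supp}\,\mu$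 if it induces regularity on some relatively open neighborhood $U\subset\mathrm{supp}\,\mu$ of $x$. Finally, $\Sigma_\pi=\{x\in\mathrm{supp}\,\mu\mid\pi\text{ does not induce regularity at }x\}$. *)

theory Defs
  imports "HOL-Probability.Probability"
begin

definition geodesic_space :: "'a::metric_space set \<Rightarrow> bool" where
  "geodesic_space S \<longleftrightarrow>
    (\<forall>x\<in>S. \<forall>y\<in>S. \<exists>\<gamma>::real \<Rightarrow> 'a.
       \<gamma> ` {0..dist x y} \<subseteq> S \<and> \<gamma> 0 = x \<and> \<gamma> (dist x y) = y \<and>
       (\<forall>s\<in>{0..dist x y}. \<forall>t\<in>{0..dist x y}. dist (\<gamma> s) (\<gamma> t) = \<bar>s - t\<bar>))"

text \<open>A parameter-free version of the library's \<^const>\<open>local_lipschitz\<close>.\<close>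

definition locally_lipschitz_on :: "'a::metric_space set \<Rightarrow> ('a \<Rightarrow> 'b::metric_space) \<Rightarrow> bool" where
  "locally_lipschitz_on S f \<longleftrightarrow>
    (\<forall>x\<in>S. \<exists>u>0. \<exists>L. L-lipschitz_on (cball x u \<inter> S) f)"

definition borel_prob_measures :: "'a::topological_space measure set" where
  "borel_prob_measures = {\<mu>. prob_space \<mu> \<and> sets \<mu> = sets borel}"

text \<open>
  Plans live on the Borel sigma-algebra of the product topology, which without second
  countability may be larger than the product of the Borel sigma-algebras.
\<close>

definition couplings ::
    "'a::topological_space measure \<Rightarrow> 'b::topological_space measure \<Rightarrow> ('a \<times> 'b) measure set" where
  "couplings \<mu> \<nu> =
    {\<pi> \<in> borel_prob_measures. distr \<pi> borel fst = \<mu> \<and> distr \<pi> borel snd = \<nu>}"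

text \<open>
  Costs are meant to be nonnegative: \<^const>\<open>ennreal\<close> truncates negative values to 0.
\<close>

definition plan_cost :: "('a \<times> 'b \<Rightarrow> real) \<Rightarrow> ('a \<times> 'b) measure \<Rightarrow> ennreal" where
  "plan_cost c \<pi> = (\<integral>\<^sup>+ z. ennreal (c z) \<partial>\<pi>)"

definition transport_cost ::
    "('a \<times> 'b \<Rightarrow> real) \<Rightarrow> 'a::topological_space measure \<Rightarrow> 'b::topological_space measure \<Rightarrow> ennreal" where
  "transport_cost c \<mu> \<nu> = (INF \<pi>\<in>couplings \<mu> \<nu>. plan_cost c \<pi>)"

definition optimal_plan ::
    "('a \<times> 'b \<Rightarrow> real) \<Rightarrow> 'a::topological_space measure \<Rightarrow> 'b::topological_space measure
      \<Rightarrow> ('a \<times> 'b) measure \<Rightarrow> bool" where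
  "optimal_plan c \<mu> \<nu> \<pi> \<longleftrightarrow>
    \<pi> \<in> couplings \<mu> \<nu> \<and> plan_cost c \<pi> = transport_cost c \<mu> \<nu>"

text \<open>
  The intersection of all closed sets of full measure. Under second countability it has full
  measure itself (\<open>msupp_full_measure\<close> below), so it is the smallest such set.
\<close>

definition msupp :: "'a::topological_space measure \<Rightarrow> 'a set" where
  "msupp \<mu> = \<Inter>{C. closed C \<and> emeasure \<mu> (- C) = 0}"

lemma closed_msupp: "closed (msupp \<mu>)"
  by (auto simp: msupp_def)

lemma msupp_least: "closed C \<Longrightarrow> emeasure \<mu> (- C) = 0 \<Longrightarrow> msupp \<mu> \<subseteq> C"
  by (auto simp: msupp_def)

lemma msupp_full_measure:
  fixes \<mu> :: "'a::second_countable_topology measure"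
  assumes "sets \<mu> = sets borel"
  shows "emeasure \<mu> (- msupp \<mu>) = 0"
proof -
  let ?F = "{V. open V \<and> emeasure \<mu> V = 0}"
  obtain F where F: "F \<subseteq> ?F" "countable F" "\<Union>F = \<Union>?F"
    using Lindelof[of ?F] by auto
  have "V \<in> null_sets \<mu>" if "V \<in> F" for V
    using that F(1) assms by (auto simp: null_sets_def)
  then have "\<Union>F \<in> null_sets \<mu>"
    using null_sets_UN'[OF F(2), of "\<lambda>V. V"] by simp
  moreover have "- msupp \<mu> = \<Union>?F"
  proof (intro equalityI subsetI)
    fix x assume "x \<in> \<Union>?F"
    then obtain V where "x \<in> V" "open V" "emeasure \<mu> V = 0" by auto
    then show "x \<in> - msupp \<mu>" using msupp_least[of "- V" \<mu>] by auto
  qed (auto simp: msupp_def open_Compl)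
  ultimately show ?thesis using F(3) by auto
qed

definition induces_regularity_on ::
    "'a::topological_space measure \<Rightarrow> 'b::topological_space measure \<Rightarrow> ('a \<times> 'b) measure
      \<Rightarrow> 'a set \<Rightarrow> bool" where
  "induces_regularity_on \<mu> \<nu> \<pi> U \<longleftrightarrow>
    openin (top_of_set (msupp \<mu>)) U \<and>
    (\<exists>K. compact K \<and> K \<subseteq> msupp \<nu> \<and>
       fst ` msupp \<pi> \<inter> U = fst ` (msupp \<pi> \<inter> (U \<times> K)))"

definition induces_regularity_at ::
    "'a::topological_space measure \<Rightarrow> 'b::topological_space measure \<Rightarrow> ('a \<times> 'b) measure
      \<Rightarrow> 'a \<Rightarrow> bool" where
  "induces_regularity_at \<mu> \<nu> \<pi> x \<longleftrightarrow> (\<exists>U. x \<in> U \<and> induces_regularity_on \<mu> \<nu> \<pi> U)"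

definition singular_points ::
    "'a::topological_space measure \<Rightarrow> 'b::topological_space measure \<Rightarrow> ('a \<times> 'b) measure
      \<Rightarrow> 'a set" where
  "singular_points \<mu> \<nu> \<pi> = {x \<in> msupp \<mu>. \<not> induces_regularity_at \<mu> \<nu> \<pi> x}"

end

theory Submission
  imports Defs
begin

text \<open>
  Let \<open>x\<^sub>0\<close> be interior to the support of \<open>\<mu>\<close>. For \<open>(x, y) \<in> supp \<pi>\<close> with \<open>x\<close> near \<open>x\<^sub>0\<close> and \<open>y\<close> far
  away, the geodesic from \<open>x\<close> to \<open>y\<close> passes, after length \<open>r / 2\<close>, close to one of finitely many
  points \<open>p\<close> with \<open>(p, q) \<in> supp \<pi>\<close>, so that \<open>d(p, y) \<le> d(x, y) - r / 4\<close>. As \<open>\<pi>\<close> is optimal,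
  \<open>h(d(x, y)) - h(d(p, y)) \<le> h(d(x, q)) - h(d(p, q))\<close>. The right-hand side is bounded, while the
  left-hand side tends to infinity with \<open>d(x, y)\<close> because \<open>h'\<close> does. Hence \<open>y\<close> remains in a bounded
  set, which is relatively compact by the Hopf--Rinow theorem.
\<close>

subsection \<open>Differentiability almost everywhere of Lipschitz functions of one variable\<close>

lemma emeasure_interval_measure_Ioo:
  fixes F :: "real \<Rightarrow> real"
  assumes "a \<le> b" and mono: "\<And>x y. x \<le> y \<Longrightarrow> F x \<le> F y" and cont: "continuous_on UNIV F"
  shows "emeasure (interval_measure F) {a<..<b} = F b - F a"
proof (cases "a = b")
  case False
  have Icc: "emeasure (interval_measure F) {x..y} = F y - F x" if "x \<le> y" for x y
    using emeasure_interval_measure_Icc[OF that mono cont] by simp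
  have pt: "{x} \<in> null_sets (interval_measure F)" for x
    using Icc[of x x] by (intro null_setsI) auto
  have "{a, b} \<in> null_sets (interval_measure F)"
    using null_sets.Un[OF pt[of a] pt[of b]] by (simp add: insert_commute)
  then have "emeasure (interval_measure F) ({a<..<b} \<union> {a, b}) = emeasure (interval_measure F) {a<..<b}"
    by (intro emeasure_Un_null_set) auto
  moreover have "{a<..<b} \<union> {a, b} = {a..b}"
    using assms(1) by auto
  ultimately show ?thesis
    using Icc[of a b] assms(1) by simp
qed simp

text \<open>Both sides are Borel measures in \<open>A\<close>. They agree on open intervals, where
  continuity leaves no mass at the end points, and this characterises Lebesgue measure. It follows
  that each interval measure is dominated by \<open>lborel\<close>.\<close>

lemma interval_measure_add_eq_lborel:
  fixes F G :: "real \<Rightarrow> real"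
  assumes F: "mono F" "continuous_on UNIV F" and G: "mono G" "continuous_on UNIV G"
    and sum: "\<And>x. F x + G x = x" and A: "A \<in> sets borel"
  shows "emeasure (interval_measure F) A + emeasure (interval_measure G) A = emeasure lborel A"
proof -
  define N where "N = measure_of UNIV (sets borel)
    (\<lambda>A. emeasure (interval_measure F) A + emeasure (interval_measure G) A)"
  have sN: "sets N = sets borel"
    using sets.sigma_sets_eq[of "borel :: real measure"] by (simp add: N_def sets_measure_of_conv)
  have N: "emeasure N A = emeasure (interval_measure F) A + emeasure (interval_measure G) A"
    if "A \<in> sets borel" for A
  proof (rule emeasure_measure_of[OF N_def])
    show "countably_additive (sets N)
        (\<lambda>A. emeasure (interval_measure F) A + emeasure (interval_measure G) A)"
      unfolding countably_additive_def sN
    proof safe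
      fix B :: "nat \<Rightarrow> real set" assume B: "range B \<subseteq> sets borel" "disjoint_family B"
      then show "(\<Sum>i. emeasure (interval_measure F) (B i) + emeasure (interval_measure G) (B i))
        = emeasure (interval_measure F) (\<Union>i. B i) + emeasure (interval_measure G) (\<Union>i. B i)"
        by (subst suminf_add[symmetric]) (auto intro!: arg_cong2[where f="(+)"] suminf_emeasure)
    qed
  qed (use that sN in \<open>auto simp: positive_def\<close>)
  have "lborel = N"
  proof (rule lborel_eqI)
    fix l u :: real assume "\<And>b. b \<in> Basis \<Longrightarrow> l \<bullet> b \<le> u \<bullet> b"
    then have lu: "l \<le> u" by simp
    then have "emeasure N (box l u) = ennreal (F u - F l) + ennreal (G u - G l)"
      using F G by (simp add: N box_real emeasure_interval_measure_Ioo monoD)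
    also have "\<dots> = ennreal (u - l)"
      using monoD[OF F(1) lu] monoD[OF G(1) lu] sum[of u] sum[of l]
      by (simp flip: ennreal_plus add: algebra_simps)
    finally show "emeasure N (box l u) = ennreal (\<Prod>b\<in>Basis. (u - l) \<bullet> b)" by simp
  qed (rule sN)
  then show ?thesis using N[OF A] by simp
qed

text \<open>
  Vitali intervals inside an outer approximation of \<open>{f \<le> p}\<close> have a union \<open>W\<close> satisfying both
  \<open>q |W| \<le> M W\<close> and \<open>M W \<le> p |W| + \<epsilon>\<close>, which forces \<open>|W| \<le> \<epsilon> / (q - p)\<close>.
\<close>

lemma negligible_upper_derivate_gt_density:
  fixes f :: "real \<Rightarrow> ennreal" and p q s t :: real
  assumes sM: "sets M = sets borel" and dens: "M = density lborel f"
    and f[measurable]: "f \<in> borel_measurable borel"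
    and le: "\<And>A. A \<in> sets borel \<Longrightarrow> emeasure M A \<le> emeasure lborel A"
    and pq: "0 \<le> p" "p < q"
  shows "negligible {x\<in>{s<..<t}. f x \<le> ennreal p \<and>
     (\<forall>d>0. \<exists>u v. u < v \<and> u \<le> x \<and> x \<le> v \<and> v - u < d \<and> ennreal (q * (v - u)) \<le> emeasure M {u..v})}"
    (is "negligible ?N")
  unfolding negligible_outer_le
proof (intro allI impI)
  fix e :: real assume e: "e > 0"
  define E where "E = {x\<in>{s<..<t}. f x \<le> ennreal p}"
  have E[measurable]: "E \<in> sets borel" unfolding E_def by measurable
  \<comment> \<open>The factor \<open>q - p\<close> in this margin cancels in the final estimate,
    which leaves \<open>w \<le> e\<close>.\<close>
  have "0 < e * (q - p)" using e pq by simp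
  from outer_regular_lborel_le[OF E this] obtain V
    where V: "open V" "E \<subseteq> V" "emeasure lborel (V - E) \<le> ennreal (e * (q - p))" by blast
  \<comment> \<open>The bounded interval keeps the measure of \<open>W\<close> below finite, so that
    \<open>p * w\<close> can be subtracted at the end.\<close>
  define O' where "O' = V \<inter> {s<..<t}"
  have O': "open O'" "E \<subseteq> O'" "O' \<subseteq> {s<..<t}"
    using V by (auto simp: O'_def E_def)
  have [measurable]: "O' \<in> sets borel" using O'(1) by simp
  have OE: "emeasure lborel (O' - E) \<le> ennreal (e * (q - p))"
    using V(1) by (intro order_trans[OF emeasure_mono V(3)]) (auto simp: O'_def)
  define K where "K = {(u, v). u < v \<and> {u..v} \<subseteq> O' \<and> ennreal (q * (v - u)) \<le> emeasure M {u..v}}"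
  \<comment> \<open>Intervals become closed balls given by midpoint and half length, the form
    required by the covering theorem.\<close>
  define a where "a = (\<lambda>(u, v). (u + v) / 2 :: real)"
  define r where "r = (\<lambda>(u, v). (v - u) / 2 :: real)"
  have cb: "cball (a i) (r i) = {fst i..snd i}" for i
    by (auto simp: a_def r_def cball_eq_atLeastAtMost field_simps split: prod.split)
  obtain C where C: "countable C" "C \<subseteq> K"
     "pairwise (\<lambda>i j. disjnt (cball (a i) (r i)) (cball (a j) (r j))) C"
     "negligible (?N - (\<Union>i \<in> C. cball (a i) (r i)))"
  proof (rule Vitali_covering_theorem_cballs[of K r ?N a])
    show "0 < r i" if "i \<in> K" for i using that by (auto simp: K_def r_def)
  next
    fix x d :: real assume x: "x \<in> ?N" and d: "0 < d"
    have "x \<in> O'" using x O'(2) by (auto simp: E_def)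
    then obtain k where k: "k > 0" "ball x k \<subseteq> O'" using O'(1) by (meson openE)
    have "min d k > 0" using d k by simp
    with x obtain u v where uv: "u < v" "u \<le> x" "x \<le> v" "v - u < min d k"
      "ennreal (q * (v - u)) \<le> emeasure M {u..v}" by blast
    have "{u..v} \<subseteq> ball x k" using uv by (auto simp: dist_real_def)
    then have "(u, v) \<in> K" using uv k by (auto simp: K_def)
    moreover have "x \<in> cball (a (u, v)) (r (u, v))" unfolding cb using uv by simp
    moreover have "r (u, v) < d" using uv by (simp add: r_def)
    ultimately show "\<exists>i. i \<in> K \<and> x \<in> cball (a i) (r i) \<and> r i < d" by blast
  qed
  define W where "W = (\<Union>i\<in>C. {fst i..snd i})"
  have W[measurable]: "W \<in> sets borel" unfolding W_def using C(1) by (intro sets.countable_UN'') auto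
  have WO: "W \<subseteq> O'" using C(2) by (fastforce simp: W_def K_def)
  have disj: "disjoint_family_on (\<lambda>i. {fst i..snd i}) C"
    using C(3) unfolding cb by (simp add: disjoint_family_on_def pairwise_def disjnt_def)
  \<comment> \<open>Countable additivity, written with the counting measure on \<open>C\<close>,
    bounds the mass of \<open>W\<close> from below. For the upper bound \<open>W\<close> is split
    along \<open>E\<close>: the density is at most \<open>p\<close> on \<open>E\<close>, and outside
    \<open>E\<close> domination by \<open>lborel\<close> suffices.\<close>
  have "ennreal q * emeasure lborel W = ennreal q * (\<integral>\<^sup>+i. emeasure lborel {fst i..snd i} \<partial>count_space C)"
    unfolding W_def using C(1) disj by (subst emeasure_UN_countable) auto
  also have "\<dots> = (\<integral>\<^sup>+i. ennreal q * emeasure lborel {fst i..snd i} \<partial>count_space C)"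
    by (subst nn_integral_cmult) auto
  also have "\<dots> \<le> (\<integral>\<^sup>+i. emeasure M {fst i..snd i} \<partial>count_space C)"
    using C(2) pq by (intro nn_integral_mono) (fastforce simp: K_def ennreal_mult)
  also have "\<dots> = emeasure M W"
    unfolding W_def using C(1) disj sM by (subst emeasure_UN_countable) auto
  also have "\<dots> \<le> emeasure M (W \<inter> E) + emeasure M (W - E)"
    using sM by (subst plus_emeasure) (auto simp: Int_Diff_Un)
  also have "emeasure M (W \<inter> E) = (\<integral>\<^sup>+x. f x * indicator (W \<inter> E) x \<partial>lborel)"
    unfolding dens by (subst emeasure_density) auto
  also have "\<dots> \<le> (\<integral>\<^sup>+x. ennreal p * indicator (W \<inter> E) x \<partial>lborel)"
    by (intro nn_integral_mono) (auto simp: E_def split: split_indicator)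
  also have "\<dots> = ennreal p * emeasure lborel (W \<inter> E)"
    by (subst nn_integral_cmult_indicator) auto
  also have "\<dots> \<le> ennreal p * emeasure lborel W"
    by (intro mult_left_mono emeasure_mono) auto
  also have "emeasure M (W - E) \<le> emeasure lborel (W - E)"
    by (rule le) simp
  also have "\<dots> \<le> emeasure lborel (O' - E)"
    using WO by (intro emeasure_mono) auto
  also note OE
  finally have main: "ennreal q * emeasure lborel W \<le> ennreal p * emeasure lborel W + ennreal (e * (q - p))"
    by (simp add: add_mono)
  have "emeasure lborel W \<le> emeasure lborel {s<..<t}"
    using WO O'(3) by (intro emeasure_mono) auto
  also have "\<dots> < \<infinity>" by (cases "s \<le> t") auto
  finally have Wfin: "emeasure lborel W < \<infinity>" .
  define w where "w = measure lborel W"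
  have w: "emeasure lborel W = ennreal w" "w \<ge> 0"
    using Wfin by (auto simp: w_def emeasure_eq_ennreal_measure)
  have "q * w \<le> p * w + e * (q - p)"
    using main pq e w by (simp add: w ennreal_mult[symmetric] ennreal_plus[symmetric] del: ennreal_plus)
  then have "(q - p) * w \<le> (q - p) * e" by (simp add: algebra_simps)
  then have we: "w \<le> e" using pq by simp
  \<comment> \<open>The Vitali intervals miss only a negligible remainder, added here to obtain a
    cover.\<close>
  define T where "T = W \<union> (?N - W)"
  have neg: "negligible (?N - W)" using C(4) by (simp add: W_def cb)
  have Wl: "W \<in> lmeasurable" using Wfin by (simp add: fmeasurable_def)
  have "T \<in> lmeasurable" unfolding T_def
    using neg Wl by (intro fmeasurable.Un) (auto simp: negligible_imp_measurable)
  moreover have "measure lebesgue T \<le> e"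
  proof -
    have "measure lebesgue T = measure lebesgue W"
      unfolding T_def using neg Wl
      by (intro measure_Un_null_set) (simp_all only: negligible_iff_null_sets fmeasurableD)
    also have "\<dots> = w" by (simp add: w_def)
    finally show ?thesis using we by simp
  qed
  moreover have "?N \<subseteq> T" by (auto simp: T_def)
  ultimately show "\<exists>T. ?N \<subseteq> T \<and> T \<in> lmeasurable \<and> measure lebesgue T \<le> e" by blast
qed
text \<open>If the bound fails at \<open>x\<close> for some \<open>q\<close>, rationals with
  \<open>f x < p < q' < q\<close> and a natural number \<open>n\<close> above the absolute value of
  \<open>x\<close> place \<open>x\<close> in one of countably many negligible sets
  \<open>N n p q'\<close>.\<close>

lemma AE_upper_derivate_le_density:
  fixes f :: "real \<Rightarrow> ennreal"
  assumes sM: "sets M = sets borel" and dens: "M = density lborel f"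
    and f: "f \<in> borel_measurable borel"
    and le: "\<And>A. A \<in> sets borel \<Longrightarrow> emeasure M A \<le> emeasure lborel A"
  shows "AE x in lborel. \<forall>q::real. f x < ennreal q \<longrightarrow> (\<exists>d>0. \<forall>u v. u < v \<and> u \<le> x \<and> x \<le> v \<and> v - u < d
           \<longrightarrow> emeasure M {u..v} < ennreal (q * (v - u)))"
proof -
  define N where "N n p q = {x\<in>{- real n<..<real n}. f x \<le> ennreal p \<and>
     (\<forall>d>0. \<exists>u v. u < v \<and> u \<le> x \<and> x \<le> v \<and> v - u < d \<and> ennreal (q * (v - u)) \<le> emeasure M {u..v})}"
    for n :: nat and p q :: real
  define I where "I = (UNIV :: nat set) \<times> {(p :: real, q :: real). p \<in> \<rat> \<and> q \<in> \<rat> \<and> 0 \<le> p \<and> p < q}"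
  have "countable I" unfolding I_def
    by (intro countable_SIGMA countable_subset[OF _ countable_SIGMA[OF countable_rat countable_rat]]) auto
  then have "(\<Union>(n, p, q)\<in>I. N n p q) \<in> null_sets lebesgue"
    using negligible_upper_derivate_gt_density[OF sM dens f le]
    by (intro null_sets_UN') (auto simp: I_def N_def negligible_iff_null_sets)
  \<comment> \<open>A Lebesgue null set is enlarged to a Borel null set, because the claim concerns
    \<open>lborel\<close>.\<close>
  then obtain N' where N': "N' \<in> null_sets lborel" "(\<Union>(n, p, q)\<in>I. N n p q) \<subseteq> N'"
    by (auto simp: null_sets_completion_iff2)
  show ?thesis
  proof (rule AE_I'[OF N'(1)], rule subsetI, rule ccontr)
    fix x assume "x \<notin> N'"
    then have nN: "x \<notin> N n p q" if "(n, p, q) \<in> I" for n p q using N'(2) that by fast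
    obtain n where n: "\<bar>x\<bar> < real n" using reals_Archimedean2 by blast
    have "\<exists>d>0. \<forall>u v. u < v \<and> u \<le> x \<and> x \<le> v \<and> v - u < d \<longrightarrow> emeasure M {u..v} < ennreal (q * (v - u))"
      if q: "f x < ennreal q" for q :: real
    proof -
      obtain y where y: "f x = ennreal y" "0 \<le> y" "y < q"
        using q by (cases "f x") (auto simp: ennreal_less_iff)
      obtain p where p: "p \<in> \<rat>" "y < p" "p < q" using Rats_dense_in_real[OF y(3)] by blast
      obtain q' where q': "q' \<in> \<rat>" "p < q'" "q' < q" using Rats_dense_in_real[OF p(3)] by blast
      have "x \<notin> N n p q'" using p q' y by (intro nN) (auto simp: I_def)
      moreover have "f x \<le> ennreal p" using y p by (simp add: ennreal_leI)
      ultimately have "\<not> (\<forall>d>0. \<exists>u v. u < v \<and> u \<le> x \<and> x \<le> v \<and> v - u < d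
          \<and> ennreal (q' * (v - u)) \<le> emeasure M {u..v})"
        using n unfolding N_def by auto
      then obtain d where d: "d > 0"
        "\<And>u v. u < v \<Longrightarrow> u \<le> x \<Longrightarrow> x \<le> v \<Longrightarrow> v - u < d \<Longrightarrow> emeasure M {u..v} < ennreal (q' * (v - u))"
        by (metis not_le)
      moreover have "ennreal (q' * (v - u)) \<le> ennreal (q * (v - u))" if "u < v" for u v
        using q' that by (intro ennreal_leI mult_right_mono) auto
      ultimately show ?thesis by (meson order_less_le_trans)
    qed
    moreover assume "x \<in> {x \<in> space lborel. \<not> (\<forall>q::real. f x < ennreal q \<longrightarrow> (\<exists>d>0. \<forall>u v. u < v \<and> u \<le> x \<and> x \<le> v \<and> v - u < d
           \<longrightarrow> emeasure M {u..v} < ennreal (q * (v - u))))}"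
    ultimately show False by blast
  qed
qed

text \<open>
  The measures of \<open>G\<close> and of \<open>x - G x\<close> add up to Lebesgue measure, so both have densities, with sum
  1, and the upper derivate bound for the second is the lower derivate bound for the first.
\<close>

lemma mono_contraction_AE_derivative:
  fixes G :: "real \<Rightarrow> real"
  assumes mono: "mono G" and contr: "\<And>x y. x \<le> y \<Longrightarrow> G y - G x \<le> y - x"
  obtains g :: "real \<Rightarrow> real" where "g \<in> borel_measurable borel"
    "\<And>a b. a \<le> b \<Longrightarrow> (\<integral>\<^sup>+x. ennreal (g x) * indicator {a..b} x \<partial>lborel) = ennreal (G b - G a)"
    "AE x in lborel. (G has_real_derivative g x) (at x)"
proof -
  define H where "H = (\<lambda>x. x - G x)"
  have G1: "dist (G x) (G y) \<le> 1 * dist x y" for x y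
    using monoD[OF mono, of x y] monoD[OF mono, of y x] contr[of x y] contr[of y x]
    by (cases "x \<le> y") (auto simp: dist_real_def)
  have contG: "continuous_on UNIV G"
    by (rule lipschitz_on_continuous_on[OF lipschitz_onI[OF G1]]) auto
  have contH: "continuous_on UNIV H" unfolding H_def using contG by (intro continuous_intros)
  have monoH: "mono H"
    using contr by (intro monoI) (simp add: H_def algebra_simps)
  let ?M = "interval_measure G" and ?N = "interval_measure H"
  have sum: "emeasure ?M A + emeasure ?N A = emeasure lborel A" if "A \<in> sets borel" for A
    using interval_measure_add_eq_lborel[OF mono contG monoH contH _ that] by (simp add: H_def)
  have leM: "emeasure ?M A \<le> emeasure lborel A" and leN: "emeasure ?N A \<le> emeasure lborel A"
    if "A \<in> sets borel" for A
    using sum[OF that, symmetric] by auto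
  have "absolutely_continuous lborel ?M" "absolutely_continuous lborel ?N"
    using leM leN by (auto simp: absolutely_continuous_def null_sets_def) (metis le_zero_eq)+
  then obtain f1 f2 where f1[measurable]: "f1 \<in> borel_measurable lborel" and d1: "density lborel f1 = ?M"
    and f2[measurable]: "f2 \<in> borel_measurable lborel" and d2: "density lborel f2 = ?N"
    using sigma_finite_measure.Radon_Nikodym[OF sigma_finite_lborel, of ?M] sigma_finite_measure.Radon_Nikodym[OF sigma_finite_lborel, of ?N] by auto
  have "density lborel (\<lambda>x. f1 x + f2 x) = density lborel (\<lambda>x. 1)"
  proof (rule measure_eqI)
    fix A assume "A \<in> sets (density lborel (\<lambda>x. f1 x + f2 x))"
    then have A[measurable]: "A \<in> sets borel" by simp
    have "emeasure (density lborel (\<lambda>x. f1 x + f2 x)) A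
      = (\<integral>\<^sup>+x. f1 x * indicator A x + f2 x * indicator A x \<partial>lborel)"
      by (simp add: emeasure_density distrib_right)
    also have "\<dots> = emeasure (density lborel f1) A + emeasure (density lborel f2) A"
      by (simp add: emeasure_density nn_integral_add)
    also have "\<dots> = emeasure (density lborel (\<lambda>x. 1)) A"
      by (simp add: d1 d2 sum emeasure_density)
    finally show "emeasure (density lborel (\<lambda>x. f1 x + f2 x)) A = emeasure (density lborel (\<lambda>x. 1)) A" .
  qed simp
  then have AE1: "AE x in lborel. f1 x + f2 x = 1"
    by (subst (asm) sigma_finite_measure.density_unique_iff[OF sigma_finite_lborel]) auto
  have AE2: "AE x in lborel. \<forall>q::real. f1 x < ennreal q \<longrightarrow> (\<exists>d>0. \<forall>u v. u < v \<and> u \<le> x \<and> x \<le> v \<and> v - u < d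
           \<longrightarrow> emeasure ?M {u..v} < ennreal (q * (v - u)))"
    using AE_upper_derivate_le_density[OF _ d1[symmetric] _ leM] by simp
  have AE3: "AE x in lborel. \<forall>q::real. f2 x < ennreal q \<longrightarrow> (\<exists>d>0. \<forall>u v. u < v \<and> u \<le> x \<and> x \<le> v \<and> v - u < d
           \<longrightarrow> emeasure ?N {u..v} < ennreal (q * (v - u)))"
    using AE_upper_derivate_le_density[OF _ d2[symmetric] _ leN] by simp
  \<comment> \<open>Since \<open>f1 + f2 = 1\<close> almost everywhere, \<open>f1\<close> is finite
    there and \<open>enn2real\<close> loses nothing.\<close>
  define g where "g = (\<lambda>x. enn2real (f1 x))"
  have eM: "emeasure ?M {u..v} = ennreal (G v - G u)" and eN: "emeasure ?N {u..v} = ennreal (H v - H u)"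
    if "u \<le> v" for u v
    using emeasure_interval_measure_Icc[OF that] mono monoH contG contH by (auto simp: monoD)
  show thesis
  proof
    show [measurable]: "g \<in> borel_measurable borel" using f1 by (simp add: g_def)
    show "(\<integral>\<^sup>+x. ennreal (g x) * indicator {a..b} x \<partial>lborel) = ennreal (G b - G a)" if "a \<le> b" for a b
    proof -
      have "(\<integral>\<^sup>+x. ennreal (g x) * indicator {a..b} x \<partial>lborel) = (\<integral>\<^sup>+x. f1 x * indicator {a..b} x \<partial>lborel)"
      proof (rule nn_integral_cong_AE, use AE1 in eventually_elim)
        fix x assume "f1 x + f2 x = 1"
        then have "f1 x < top" by (cases "f1 x") auto
        then show "ennreal (g x) * indicator {a..b} x = f1 x * indicator {a..b} x" by (simp add: g_def)
      qed
      also have "\<dots> = emeasure ?M {a..b}" by (simp add: d1[symmetric] emeasure_density)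
      finally show ?thesis using eM[OF that] by simp
    qed
    show "AE x in lborel. (G has_real_derivative g x) (at x)"
      using AE1 AE2 AE3
    proof eventually_elim
      fix x assume s: "f1 x + f2 x = 1"
        and u1: "\<forall>q::real. f1 x < ennreal q \<longrightarrow> (\<exists>d>0. \<forall>u v. u < v \<and> u \<le> x \<and> x \<le> v \<and> v - u < d
           \<longrightarrow> emeasure ?M {u..v} < ennreal (q * (v - u)))"
        and u2: "\<forall>q::real. f2 x < ennreal q \<longrightarrow> (\<exists>d>0. \<forall>u v. u < v \<and> u \<le> x \<and> x \<le> v \<and> v - u < d
           \<longrightarrow> emeasure ?N {u..v} < ennreal (q * (v - u)))"
      obtain a b where ab: "f1 x = ennreal a" "f2 x = ennreal b" "0 \<le> a" "0 \<le> b"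
        using s by (cases "f1 x"; cases "f2 x") auto
      have "a + b = 1" using s ab by (simp flip: ennreal_plus)
      have ga: "g x = a" using ab by (simp add: g_def)
      have "((\<lambda>z. (G z - G x) / (z - x)) \<longlongrightarrow> a) (at x)"
      proof (rule tendstoI)
        fix e :: real assume e: "0 < e"
        obtain d1 where d1: "d1 > 0" "\<And>u v. u < v \<Longrightarrow> u \<le> x \<Longrightarrow> x \<le> v \<Longrightarrow> v - u < d1
           \<Longrightarrow> emeasure ?M {u..v} < ennreal ((a + e) * (v - u))"
          using u1[rule_format, of "a + e"] ab e by (auto simp: ennreal_less_iff)
        obtain d2 where d2: "d2 > 0" "\<And>u v. u < v \<Longrightarrow> u \<le> x \<Longrightarrow> x \<le> v \<Longrightarrow> v - u < d2
           \<Longrightarrow> emeasure ?N {u..v} < ennreal ((b + e) * (v - u))"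
          using u2[rule_format, of "b + e"] ab e by (auto simp: ennreal_less_iff)
        \<comment> \<open>The cases \<open>u = x\<close> and \<open>v = x\<close> yield the
          difference quotients from the right and from the left.\<close>
        have bound: "\<bar>(G v - G u) / (v - u) - a\<bar> < e"
          if uv: "u < v" "u \<le> x" "x \<le> v" "v - u < min d1 d2" for u v
        proof -
          have "G v - G u < (a + e) * (v - u)"
            using d1(2)[of u v] uv monoD[OF mono, of u v] by (simp add: eM ennreal_less_iff)
          moreover have "H v - H u < (b + e) * (v - u)"
            using d2(2)[of u v] uv monoD[OF monoH, of u v] by (simp add: eN ennreal_less_iff)
          then have "(v - u) - (G v - G u) < (1 - a + e) * (v - u)"
            using \<open>a + b = 1\<close> by (simp add: H_def algebra_simps flip: \<open>a + b = 1\<close>)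
          then have "(a - e) * (v - u) < G v - G u" by (simp add: algebra_simps)
          ultimately have "(G v - G u) / (v - u) < a + e" "a - e < (G v - G u) / (v - u)"
            using uv(1) by (simp_all add: field_simps)
          then show ?thesis by linarith
        qed
        show "\<forall>\<^sub>F z in at x. dist ((G z - G x) / (z - x)) a < e"
          unfolding eventually_at
        proof (intro exI[of _ "min d1 d2"] conjI ballI impI)
          fix z assume z: "z \<noteq> x \<and> dist z x < min d1 d2"
          show "dist ((G z - G x) / (z - x)) a < e"
          proof (cases "x < z")
            case True
            then show ?thesis using bound[of x z] z by (simp add: dist_real_def)
          next
            case False
            then have "z < x" using z by simp
            moreover have "(G z - G x) / (z - x) = (G x - G z) / (x - z)"
              by (metis minus_diff_eq minus_divide_divide)
            ultimately show ?thesis using bound[of z x] z by (simp add: dist_real_def)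
          qed
        qed (use d1 d2 in auto)
      qed
      then show "(G has_real_derivative g x) (at x)" by (simp add: has_field_derivative_iff ga)
    qed
  qed
qed

section \<open>From derivatives almost everywhere to bounds on increments\<close>

text \<open>A substitute for the mean value theorem: were every derivative in the interval at least
  \<open>K\<close>, integrating the almost everywhere derivative would give an increment of at least
  \<open>K * (t - s)\<close>.\<close>

lemma lipschitz_exists_derivative_less:
  fixes F :: "real \<Rightarrow> real"
  assumes lip: "L-lipschitz_on UNIV F" and st: "s < t" and less: "F t - F s < K * (t - s)"
  obtains x D where "s < x" "x < t" "D < K" "(F has_real_derivative D) (at x)"
proof -
  \<comment> \<open>Adding 1 keeps \<open>c\<close> positive even for \<open>L = 0\<close>, so that
    \<open>2 * c\<close> can be a divisor.\<close>
  define c where "c = L + 1"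
  have c: "c > 0" using lipschitz_on_nonneg[OF lip] by (simp add: c_def)
  have Fc: "\<bar>F y - F x\<bar> \<le> c * (y - x)" if "x \<le> y" for x y
  proof -
    have "\<bar>F y - F x\<bar> \<le> L * (y - x)"
      using lipschitz_onD[OF lip, of y x] that by (simp add: dist_real_def)
    also have "\<dots> \<le> c * (y - x)" using that by (intro mult_right_mono) (auto simp: c_def)
    finally show ?thesis .
  qed
  \<comment> \<open>Slopes of \<open>F\<close> lie between \<open>-c\<close> and \<open>c\<close>;
    this affine change moves them between 0 and 1, as \<open>mono_contraction_AE_derivative\<close>
    requires. The number \<open>k\<close> below is the image of the slope \<open>K\<close>.\<close>
  define G where "G = (\<lambda>x. (F x + c * x) / (2 * c))"
  have Gdiff: "G y - G x = ((F y - F x) + c * (y - x)) / (2 * c)" for x y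
    using c by (simp add: G_def field_simps)
  have mono: "mono G"
  proof (rule monoI)
    fix x y :: real assume "x \<le> y"
    then have "0 \<le> G y - G x" unfolding Gdiff using Fc[of x y] c
      by (intro divide_nonneg_pos) auto
    then show "G x \<le> G y" by simp
  qed
  have contr: "G y - G x \<le> y - x" if "x \<le> y" for x y
  proof -
    have "G y - G x \<le> 2 * c * (y - x) / (2 * c)"
      unfolding Gdiff using Fc[OF that] c by (intro divide_right_mono) auto
    then show ?thesis using c by simp
  qed
  obtain g where g[measurable]: "g \<in> borel_measurable borel"
    and int: "\<And>a b. a \<le> b \<Longrightarrow> (\<integral>\<^sup>+x. ennreal (g x) * indicator {a..b} x \<partial>lborel) = ennreal (G b - G a)"
    and der: "AE x in lborel. (G has_real_derivative g x) (at x)"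
    using mono_contraction_AE_derivative[OF mono contr] by blast
  define k where "k = (K + c) / (2 * c)"
  have Gst: "G t - G s < k * (t - s)"
  proof -
    have "G t - G s < (K * (t - s) + c * (t - s)) / (2 * c)"
      unfolding Gdiff using less c by (intro divide_strict_right_mono) auto
    then show ?thesis by (simp add: k_def algebra_simps)
  qed
  show thesis
  proof (rule ccontr)
    assume "\<not> thesis"
    then have no: "\<And>x D. s < x \<Longrightarrow> x < t \<Longrightarrow> (F has_real_derivative D) (at x) \<Longrightarrow> K \<le> D"
      using that not_le by blast
    have "AE x in lborel. ennreal k * indicator {s<..<t} x \<le> ennreal (g x) * indicator {s..t} x"
      using der
    proof eventually_elim
      fix x assume d: "(G has_real_derivative g x) (at x)"
      have "((\<lambda>x. 2 * c * G x - c * x) has_real_derivative 2 * c * g x - c) (at x)"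
        by (auto intro!: derivative_eq_intros d)
      moreover have "(\<lambda>x. 2 * c * G x - c * x) = F" using c by (auto simp: G_def)
      ultimately have "K \<le> 2 * c * g x - c" if "x \<in> {s<..<t}"
        using no[of x] that by simp
      then have "k \<le> g x" if "x \<in> {s<..<t}"
        using that c by (simp add: k_def field_simps)
      then show "ennreal k * indicator {s<..<t} x \<le> ennreal (g x) * indicator {s..t} x"
        by (auto split: split_indicator intro: ennreal_leI)
    qed
    from nn_integral_mono_AE[OF this]
    have "(\<integral>\<^sup>+x. ennreal k * indicator {s<..<t} x \<partial>lborel) \<le> ennreal (G t - G s)"
      using int[of s t] st by simp
    moreover have "(\<integral>\<^sup>+x. ennreal k * indicator {s<..<t} x \<partial>lborel) = ennreal k * ennreal (t - s)"
      using st by (subst nn_integral_cmult_indicator) auto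
    \<comment> \<open>As \<open>ennreal\<close> truncates negative numbers, \<open>0 < k\<close> is
      needed to read the integral as a real number.\<close>
    moreover have "0 < k * (t - s)" using Gst monoD[OF mono, of s t] st by simp
    then have "0 < k" using st by (simp add: zero_less_mult_iff)
    ultimately have "k * (t - s) \<le> G t - G s"
      using monoD[OF mono, of s t] st by (simp flip: ennreal_mult)
    with Gst show False by simp
  qed
qed

text \<open>A smaller increment would, by the preceding lemma, produce a derivative below
  \<open>K\<close> strictly between \<open>s\<close> and \<open>t\<close>, against
  \<open>der\<close>.\<close>

lemma locally_lipschitz_increment_ge:
  fixes h :: "real \<Rightarrow> real"
  assumes lip: "locally_lipschitz_on {0..} h"
    and der: "\<And>a. A \<le> a \<Longrightarrow> h differentiable at a \<Longrightarrow> K \<le> deriv h a"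
    and A: "0 \<le> A" "A \<le> s" "s \<le> t"
  shows "K * (t - s) \<le> h t - h s"
proof (rule ccontr)
  assume less: "\<not> K * (t - s) \<le> h t - h s"
  then have st: "s < t" using A(3) by (cases "s = t") auto
  \<comment> \<open>The singleton is a dummy parameter set, as \<open>local_lipschitz\<close>
    concerns families of functions.\<close>
  have "local_lipschitz {0::real} {0..} (\<lambda>_. h)"
    using lip unfolding local_lipschitz_def locally_lipschitz_on_def by blast
  then have "local_lipschitz {0::real} {s..t} (\<lambda>_. h)"
    by (rule local_lipschitz_subset) (use A in auto)
  from local_lipschitz_compact_implies_lipschitz[OF this]
  obtain L where L: "L-lipschitz_on {s..t} h" by auto
  define r where "r = (\<lambda>x. max s (min t x))"
  have "L-lipschitz_on UNIV (\<lambda>x. h (r x))"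
  proof (rule lipschitz_onI)
    fix x y :: real
    have "dist (h (r x)) (h (r y)) \<le> L * dist (r x) (r y)"
      using st by (intro lipschitz_onD[OF L]) (auto simp: r_def)
    also have "\<dots> \<le> L * dist x y"
      using lipschitz_on_nonneg[OF L] by (intro mult_left_mono) (auto simp: r_def dist_real_def)
    finally show "dist (h (r x)) (h (r y)) \<le> L * dist x y" .
  qed (rule lipschitz_on_nonneg[OF L])
  moreover have "h (r t) - h (r s) < K * (t - s)" using less st by (simp add: r_def)
  ultimately obtain x D where x: "s < x" "x < t" "D < K" "((\<lambda>x. h (r x)) has_real_derivative D) (at x)"
    using lipschitz_exists_derivative_less st by blast
  have "(h has_real_derivative D) (at x)"
    by (rule has_field_derivative_transform_within_open[OF x(4), of "{s<..<t}"]) (use x in \<open>auto simp: r_def\<close>)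
  then have "h differentiable at x" "deriv h x = D"
    by (auto simp: real_differentiable_def DERIV_imp_deriv)
  then show False using der[of x] x A by auto
qed

lemma locally_lipschitz_on_imp_continuous_on:
  assumes "locally_lipschitz_on S f"
  shows "continuous_on S f"
  unfolding continuous_on_eq_continuous_within
proof
  fix x assume x: "x \<in> S"
  then obtain u L where u: "u > 0" and L: "L-lipschitz_on (cball x u \<inter> S) f"
    using assms by (auto simp: locally_lipschitz_on_def)
  have "continuous (at x within (cball x u \<inter> S)) f"
    using lipschitz_on_continuous_on[OF L] x u by (simp add: continuous_on_eq_continuous_within)
  moreover have "at x within (cball x u \<inter> S) = at x within S"
    using u by (intro at_within_nhd[of x "ball x u"]) auto
  ultimately show "continuous (at x within S) f" by (simp add: continuous_within)
qed

subsection \<open>Proper metric spaces and their Borel sets\<close>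

lemma geodesic_space_split:
  fixes x y :: "'a::metric_space"
  assumes geo: "geodesic_space (UNIV :: 'a set)" and r: "0 \<le> r" "r \<le> dist x y"
  obtains z :: 'a where "dist x z = r" "dist z y = dist x y - r"
proof -
  obtain \<gamma> :: "real \<Rightarrow> 'a" where g: "\<gamma> 0 = x" "\<gamma> (dist x y) = y"
    "\<And>s t. s \<in> {0..dist x y} \<Longrightarrow> t \<in> {0..dist x y} \<Longrightarrow> dist (\<gamma> s) (\<gamma> t) = \<bar>s - t\<bar>"
    using geo unfolding geodesic_space_def by (metis UNIV_I)
  show thesis
    using g(3)[of 0 r] g(3)[of r "dist x y"] g(1,2) r by (intro that[of "\<gamma> r"]) auto
qed

text \<open>Let \<open>R\<close> be the supremum of the radii of compact balls around
  \<open>x0\<close>. Geodesics bring each point of \<open>cball x0 R\<close> close to a smaller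
  compact ball, so \<open>cball x0 R\<close> is totally bounded and, being complete, compact. Local
  compactness then enlarges it, against the choice of \<open>R\<close>.\<close>

lemma hopf_rinow_compact_cball:
  fixes x0 :: "'a::complete_space"
  assumes lc: "locally compact (UNIV :: 'a set)" and geo: "geodesic_space (UNIV :: 'a set)"
  shows "compact (cball x0 r)"
proof (rule ccontr)
  assume nc: "\<not> compact (cball x0 r)"
  define S where "S = {r. compact (cball x0 r)}"
  have down: "a \<in> S" if "b \<in> S" "a \<le> b" for a b
  proof -
    have "cball x0 b \<inter> cball x0 a = cball x0 a" using that by auto
    then show ?thesis
      using that compact_Int_closed[of "cball x0 b" "cball x0 a"] by (simp add: S_def)
  qed
  have bound: "b < r" if "b \<in> S" for b
    using down[OF that, of r] nc by (force simp: S_def not_le)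
  have S0: "0 \<in> S" by (simp add: S_def)
  have bdd: "bdd_above S" using bound by (meson bdd_aboveI less_imp_le)
  define R where "R = Sup S"
  have R0: "0 \<le> R" unfolding R_def using S0 bdd by (rule cSup_upper)
  have tb: "\<exists>k. finite k \<and> cball x0 R \<subseteq> (\<Union>x\<in>k. ball x e)" if e: "e > 0" for e
  proof -
    have "R - e / 2 < Sup S" using e by (simp add: R_def)
    then obtain a where a: "a \<in> S" "R - e / 2 < a"
      using less_cSup_iff[of S] S0 bdd by auto
    \<comment> \<open>The radius \<open>a\<close> may be negative, as empty balls are compact, but
      splitting a geodesic needs a nonnegative length.\<close>
    define b where "b = max a 0"
    have b: "b \<in> S" "R - e / 2 < b" "0 \<le> b" using a S0 by (auto simp: b_def max_def)
    have "compact (cball x0 b)" using b(1) by (simp add: S_def)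
    then obtain k where k: "finite k" "cball x0 b \<subseteq> (\<Union>x\<in>k. ball x (e / 2))"
      using e unfolding compact_eq_totally_bounded by (meson half_gt_zero)
    have "y \<in> (\<Union>x\<in>k. ball x e)" if y: "y \<in> cball x0 R" for y
    proof -
      obtain z where z: "dist x0 z \<le> b" "dist z y < e / 2"
      proof (cases "dist x0 y \<le> b")
        case True
        then show ?thesis using that[of y] e by simp
      next
        case False
        then obtain z where "dist x0 z = b" "dist z y = dist x0 y - b"
          using geodesic_space_split[OF geo b(3), of x0 y] by auto
        then show ?thesis using that[of z] y b by simp
      qed
      then obtain x where x: "x \<in> k" "dist x z < e / 2" using k by force
      have "dist x y < e" using dist_triangle_half_r[of z x e y] x z by (simp add: dist_commute)
      then show ?thesis using x by auto
    qed
    then show ?thesis using k by blast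
  qed
  have cR: "compact (cball x0 R)"
    unfolding compact_eq_totally_bounded using tb by (simp add: complete_eq_closed)
  have "\<exists>e>0. compact (cball y e)" for y :: 'a
  proof -
    obtain u v where uv: "open u" "compact v" "y \<in> u" "u \<subseteq> v"
      using lc unfolding locally_def by (metis UNIV_I openin_open_eq open_UNIV subset_UNIV subtopology_UNIV open_openin)
    then obtain e where "e > 0" "cball y e \<subseteq> u" by (meson open_contains_cball)
    then show ?thesis
      using uv compact_Int_closed[of v "cball y e"] by (auto simp: Int_absorb1 dest: subset_trans intro!: exI[of _ e])
  qed
  then obtain e where e: "\<And>y :: 'a. e y > 0" "\<And>y. compact (cball y (e y))" by metis
  have "cball x0 R \<subseteq> (\<Union>y\<in>cball x0 R. ball y (e y))" using e(1) by auto
  from compactE_image[OF cR _ this] obtain C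
    where C: "C \<subseteq> cball x0 R" "finite C" "cball x0 R \<subseteq> (\<Union>y\<in>C. ball y (e y))" by auto
  \<comment> \<open>The finite cover has a uniform margin \<open>d\<close>, and along a geodesic
    every point at distance at most \<open>R + d / 2\<close> from \<open>x0\<close> is within
    \<open>d\<close> of \<open>cball x0 R\<close>.\<close>
  obtain d where d: "d > 0" "(\<Union>y\<in>cball x0 R. ball y d) \<subseteq> (\<Union>y\<in>C. ball y (e y))"
    using compact_subset_open_imp_ball_epsilon_subset[OF cR _ C(3)] by blast
  have "cball x0 (R + d / 2) \<subseteq> (\<Union>y\<in>cball x0 R. ball y d)"
  proof
    fix y assume y: "y \<in> cball x0 (R + d / 2)"
    show "y \<in> (\<Union>y\<in>cball x0 R. ball y d)"
    proof (cases "dist x0 y \<le> R")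
      case True
      then show ?thesis using d by (intro UN_I[of y]) auto
    next
      case False
      then obtain z where "dist x0 z = R" "dist z y = dist x0 y - R"
        using geodesic_space_split[OF geo R0, of x0 y] by auto
      then show ?thesis using y d(1) by (intro UN_I[of z]) auto
    qed
  qed
  also note d(2)
  also have "(\<Union>y\<in>C. ball y (e y)) \<subseteq> (\<Union>y\<in>C. cball y (e y))" by auto
  finally have sub: "cball x0 (R + d / 2) \<subseteq> (\<Union>y\<in>C. cball y (e y))" .
  have "compact (\<Union>y\<in>C. cball y (e y))" using C(2) e(2) by (intro compact_UN) auto
  from compact_Int_closed[OF this, of "cball x0 (R + d / 2)"]
  have "R + d / 2 \<in> S" using sub by (simp add: S_def Int_absorb1)
  then have "R + d / 2 \<le> R" unfolding R_def using bdd by (rule cSup_upper)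
  then show False using d by simp
qed

section \<open>Countable bases, Borel sets of products and full measure of supports\<close>

text \<open>Finite nets of mesh \<open>1 / (m + 1)\<close> in the balls of radius \<open>n\<close>
  have a countable dense union. The basis is produced explicitly because second countability is a
  consequence here and not part of the type class.\<close>

lemma compact_cball_countable_basis:
  assumes cpt: "\<And>(x :: 'a::metric_space) r. compact (cball x r)"
  obtains B :: "'a::metric_space set set" where "countable B" "topological_basis B"
proof -
  fix x0 :: 'a
  have "\<exists>k. finite k \<and> cball x0 (real n) \<subseteq> (\<Union>x\<in>k. ball x (inverse (real (Suc m))))" for n m :: nat
    using cpt[of x0 "real n"] unfolding compact_eq_totally_bounded
    by (meson inverse_positive_iff_positive of_nat_0_less_iff zero_less_Suc)
  then obtain k where fin: "\<And>n m. finite (k n m)"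
    and k: "\<And>n m. cball x0 (real n) \<subseteq> (\<Union>x\<in>k n m. ball x (inverse (real (Suc m))))"
    by metis
  define B where "B = (\<Union>n. \<Union>m. (\<lambda>x. ball x (inverse (real (Suc m)))) ` k n m)"
  have "countable B" unfolding B_def using fin by (intro countable_UN countable_image) (auto intro: countable_finite)
  moreover have "topological_basis B"
  proof (rule topological_basisI)
    show "open b" if "b \<in> B" for b using that by (auto simp: B_def)
  next
    fix U :: "'a set" and x assume U: "open U" "x \<in> U"
    then obtain e where e: "e > 0" "ball x e \<subseteq> U" by (meson openE)
    obtain m where m: "inverse (real (Suc m)) < e / 2" using reals_Archimedean[of "e / 2"] e by auto
    obtain n where "dist x0 x \<le> real n" using real_arch_simple by blast
    then obtain y where y: "y \<in> k n m" "dist y x < inverse (real (Suc m))" using k[of n m] by force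
    have "ball y (inverse (real (Suc m))) \<subseteq> ball x e"
    proof
      fix z assume "z \<in> ball y (inverse (real (Suc m)))"
      then show "z \<in> ball x e"
        using dist_triangle_half_r[of y x e z] y m by (simp add: dist_commute)
    qed
    then show "\<exists>b\<in>B. x \<in> b \<and> b \<subseteq> U"
      using y e(2) by (intro bexI[of _ "ball y (inverse (real (Suc m)))"]) (auto simp: B_def)
  qed
  ultimately show thesis by (rule that)
qed

text \<open>Every open set is a countable union of basic rectangles. The equality makes a map with
  Borel components Borel into the product, which is needed to construct new plans.\<close>

lemma sets_borel_prod_countable_basis:
  fixes A :: "'a::topological_space set set" and B :: "'b::topological_space set set"
  assumes A: "countable A" "topological_basis A" and B: "countable B" "topological_basis B"
  shows "sets (borel \<Otimes>\<^sub>M borel) = sets (borel :: ('a \<times> 'b) measure)"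
proof
  have [measurable]: "fst \<in> (borel :: ('a \<times> 'b) measure) \<rightarrow>\<^sub>M borel" "snd \<in> (borel :: ('a \<times> 'b) measure) \<rightarrow>\<^sub>M borel"
    by (auto intro!: borel_measurable_continuous_onI continuous_intros)
  have "a \<times> b \<in> sets borel" if "a \<in> sets borel" "b \<in> sets borel" for a :: "'a set" and b :: "'b set"
  proof -
    have "a \<times> b = (fst -` a \<inter> space borel) \<inter> (snd -` b \<inter> space borel)" by auto
    then show ?thesis using that by (metis sets.Int measurable_sets \<open>fst \<in> _\<close> \<open>snd \<in> _\<close>)
  qed
  then show "sets (borel \<Otimes>\<^sub>M borel) \<subseteq> sets (borel :: ('a \<times> 'b) measure)"
    unfolding sets_pair_measure by (intro sets.sigma_sets_subset') auto
next
  have "U \<in> sets (borel \<Otimes>\<^sub>M borel)" if "open U" for U :: "('a \<times> 'b) set"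
  proof -
    obtain \<U> where \<U>: "\<U> \<subseteq> (\<lambda>(a, b). a \<times> b) ` (A \<times> B)" "\<Union>\<U> = U"
      using topological_basis_prod[OF A(2) B(2)] \<open>open U\<close> unfolding topological_basis_def by blast
    moreover have "countable \<U>"
      using A(1) B(1) by (intro countable_subset[OF \<U>(1)] countable_image countable_SIGMA) auto
    moreover have "V \<in> sets (borel \<Otimes>\<^sub>M borel)" if "V \<in> \<U>" for V
    proof -
      obtain a b where "a \<in> A" "b \<in> B" "V = a \<times> b" using \<U>(1) \<open>V \<in> \<U>\<close> by auto
      then show ?thesis using A(2) B(2) by (auto simp: topological_basis_open)
    qed
    ultimately show ?thesis by (metis sets.countable_Union subsetI)
  qed
  then show "sets (borel :: ('a \<times> 'b) measure) \<subseteq> sets (borel \<Otimes>\<^sub>M borel)"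
    using open_UNIV unfolding borel_def[where 'a = "'a \<times> 'b"]
    by (subst sets_measure_of, simp) (rule sets.sigma_sets_subset', auto)
qed

text \<open>The counterpart of \<open>msupp_full_measure\<close> for a given basis: the null basis
  sets already cover the complement of the support.\<close>

lemma emeasure_Compl_msupp_countable_basis:
  fixes M :: "'a::topological_space measure" and B :: "'a set set"
  assumes B: "countable B" "topological_basis B" and sets: "sets M = sets borel"
  shows "emeasure M (- msupp M) = 0"
proof -
  let ?F = "{V \<in> B. emeasure M V = 0}"
  have "(\<Union>V\<in>?F. V) \<in> null_sets M"
    using B sets by (intro null_sets_UN') (auto simp: null_sets_def topological_basis_open)
  then have "\<Union>?F \<in> null_sets M" by simp
  moreover have "- msupp M \<subseteq> \<Union>?F"
  proof
    fix x assume "x \<in> - msupp M"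
    then obtain C where C: "closed C" "emeasure M (- C) = 0" "x \<in> - C" by (auto simp: msupp_def)
    then obtain V where V: "V \<in> B" "x \<in> V" "V \<subseteq> - C"
      using topological_basisE[OF B(2), of "- C" x] by (metis open_Compl)
    have "emeasure M V \<le> emeasure M (- C)" using V(3) C(1) sets by (intro emeasure_mono) auto
    then show "x \<in> \<Union>?F" using V C(2) by auto
  qed
  ultimately have "emeasure M (- msupp M) \<le> 0"
    using emeasure_mono[of "- msupp M" "\<Union>?F" M] by (simp add: null_sets_def)
  then show ?thesis by simp
qed

lemma msupp_emeasure_open_pos:
  assumes "x \<in> msupp M" "open U" "x \<in> U"
  shows "emeasure M U > 0"
proof (rule ccontr)
  assume "\<not> emeasure M U > 0"
  then have "msupp M \<subseteq> - U" using assms(2) by (intro msupp_least) auto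
  then show False using assms by auto
qed

subsection \<open>Monotonicity of optimal plans\<close>

text \<open>
  Draw two independent pairs from \<open>\<pi>\<close> and exchange their second components whenever this lowers the
  total cost. The set \<open>W\<close> where this happens is symmetric, so the law of the first pair is again a
  coupling, and it is strictly cheaper than \<open>\<pi>\<close> unless \<open>W\<close> is a null set for \<open>\<pi> \<Otimes> \<pi>\<close>.
\<close>

lemma optimal_plan_pairwise_monotone:
  fixes c :: "'a::topological_space \<times> 'b::topological_space \<Rightarrow> real"
  assumes cont: "continuous_on UNIV c" and nonneg: "\<And>z. 0 \<le> c z"
    and prod: "sets (borel \<Otimes>\<^sub>M borel) = sets (borel :: ('a \<times> 'b) measure)"
    and opt: "optimal_plan c \<mu> \<nu> \<pi>" and fin: "transport_cost c \<mu> \<nu> < \<infinity>"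
    and supp: "(x, y) \<in> msupp \<pi>" "(x', y') \<in> msupp \<pi>"
  shows "c (x, y) + c (x', y') \<le> c (x, y') + c (x', y)"
proof (rule ccontr)
  assume neg: "\<not> ?thesis"
  have \<pi>: "\<pi> \<in> couplings \<mu> \<nu>" and cost: "plan_cost c \<pi> = transport_cost c \<mu> \<nu>"
    using opt by (auto simp: optimal_plan_def)
  then have sets[measurable_cong]: "sets \<pi> = sets borel"
    and mu: "distr \<pi> borel fst = \<mu>" and nu: "distr \<pi> borel snd = \<nu>" and "prob_space \<pi>"
    by (auto simp: couplings_def borel_prob_measures_def)
  then interpret N: prob_space \<pi> by simp
  interpret NN: pair_sigma_finite \<pi> \<pi> ..
  have space: "space \<pi> = UNIV" using sets_eq_imp_space_eq[OF sets] by simp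
  define P where "P = \<pi> \<Otimes>\<^sub>M \<pi>"
  have spaceP: "space P = UNIV" by (simp add: P_def space_pair_measure space)
  interpret P: prob_space P
    unfolding P_def by (intro prob_space_pair) unfold_locales
  have f: "fst \<in> \<pi> \<rightarrow>\<^sub>M borel" and s: "snd \<in> \<pi> \<rightarrow>\<^sub>M borel" and c: "c \<in> borel_measurable \<pi>"
    using cont by (auto intro!: borel_measurable_continuous_onI continuous_intros simp: measurable_cong_sets[OF sets refl])
  then have cb: "c \<in> borel_measurable borel" by (simp add: measurable_cong_sets[OF sets refl])
  have Pf[measurable]: "fst \<in> P \<rightarrow>\<^sub>M \<pi>" "snd \<in> P \<rightarrow>\<^sub>M \<pi>" by (simp_all add: P_def)
  have pair: "(\<lambda>p. (f p, g p)) \<in> P \<rightarrow>\<^sub>M borel" if "f \<in> P \<rightarrow>\<^sub>M borel" "g \<in> P \<rightarrow>\<^sub>M borel" for f :: "_ \<Rightarrow> 'a" and g :: "_ \<Rightarrow> 'b"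
    using measurable_Pair[OF that] measurable_cong_sets[OF refl prod] by blast
  define sw where "sw = (\<lambda>p :: ('a \<times> 'b) \<times> ('a \<times> 'b). (snd p, fst p))"
  have sw[measurable]: "sw \<in> P \<rightarrow>\<^sub>M P" unfolding sw_def P_def by measurable
  have dsw: "distr P P sw = P"
    using NN.distr_pair_swap by (simp add: P_def sw_def case_prod_beta')
  have dfst: "distr P \<pi> fst = \<pi>"
  proof (rule measure_eqI)
    fix A assume "A \<in> sets (distr P \<pi> fst)"
    then have A: "A \<in> sets \<pi>" by simp
    have "fst -` A \<inter> space P = A \<times> space \<pi>" by (auto simp: spaceP space)
    then show "emeasure (distr P \<pi> fst) A = emeasure \<pi> A"
      using A Pf(1) by (simp add: emeasure_distr N.emeasure_space_1 N.emeasure_pair_measure_Times P_def)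
  qed simp
  define gap where "gap = (\<lambda>p :: ('a \<times> 'b) \<times> ('a \<times> 'b). c (fst p) + c (snd p) - (c (fst (fst p), snd (snd p)) + c (fst (snd p), snd (fst p))))"
  define W where "W = {p. 0 < gap p}"
  define T where "T = (\<lambda>p. (fst (fst p), if p \<in> W then snd (snd p) else snd (fst p)))"
  note Pm[measurable] = measurable_compose[OF Pf(1) f] measurable_compose[OF Pf(1) s]
    measurable_compose[OF Pf(2) f] measurable_compose[OF Pf(2) s]
    measurable_compose[OF Pf(1) c] measurable_compose[OF Pf(2) c]
  have [measurable]: "gap \<in> borel_measurable P"
    unfolding gap_def by (intro borel_measurable_add borel_measurable_diff Pm measurable_compose[OF pair cb])
  have W[measurable]: "W \<in> sets P"
    using measurable_sets[of gap P borel "{0<..}"] by (simp add: W_def vimage_def spaceP)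
  have T[measurable]: "T \<in> P \<rightarrow>\<^sub>M borel"
    unfolding T_def
  proof (rule pair)
    show "(\<lambda>p. if p \<in> W then snd (snd p) else snd (fst p)) \<in> P \<rightarrow>\<^sub>M borel"
      using W by (intro measurable_If_set[OF Pm(4) Pm(2)]) (simp add: spaceP)
  qed (rule Pm)
  have swW: "sw p \<in> W \<longleftrightarrow> p \<in> W" for p
    by (simp add: W_def gap_def sw_def algebra_simps)
  define \<rho> where "\<rho> = distr P borel T"
  \<comment> \<open>First components are never exchanged, so the first marginal is
    inherited.\<close>
  have "distr \<rho> borel fst = distr P borel (fst \<circ> fst)"
    using distr_distr[OF _ T, of fst borel]
    by (simp add: \<rho>_def comp_def borel_measurable_continuous_onI continuous_on_fst continuous_on_id)
      (simp add: T_def)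
  also have "\<dots> = \<mu>"
    using distr_distr[OF f Pf(1)] dfst mu by simp
  finally have \<rho>1: "distr \<rho> borel fst = \<mu>" .
  have \<rho>2: "distr \<rho> borel snd = \<nu>"
  proof (rule measure_eqI)
    show "sets (distr \<rho> borel snd) = sets \<nu>" using nu by auto
    fix F assume "F \<in> sets (distr \<rho> borel snd)"
    then have F[measurable]: "F \<in> sets borel" by simp
    define Q where "Q = {p :: ('a \<times> 'b) \<times> ('a \<times> 'b). snd (fst p) \<in> F}"
    have Qeq: "Q = (snd \<circ> fst) -` F \<inter> space P" by (auto simp: Q_def spaceP)
    then have Q[measurable]: "Q \<in> sets P"
      using measurable_sets[OF Pm(2) F] by (simp add: comp_def)
    \<comment> \<open>On \<open>W\<close> the second component of \<open>T p\<close> is that of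
      \<open>sw p\<close>. As \<open>W\<close> and \<open>P\<close> are invariant under
      \<open>sw\<close>, this part has the mass of \<open>W \<inter> Q\<close>.\<close>
    have TQ: "snd (T p) \<in> F \<longleftrightarrow> p \<in> W \<and> sw p \<in> Q \<or> p \<notin> W \<and> p \<in> Q" for p
      by (simp add: T_def Q_def sw_def)
    have "distr \<rho> borel snd = distr P borel (snd \<circ> T)"
      using distr_distr[OF _ T, of snd borel]
      by (simp add: \<rho>_def borel_measurable_continuous_onI continuous_on_snd continuous_on_id)
    moreover have "snd \<circ> T \<in> P \<rightarrow>\<^sub>M borel"
      unfolding T_def comp_def snd_conv using W by (intro measurable_If_set[OF Pm(4) Pm(2)]) (simp add: spaceP)
    ultimately have "emeasure (distr \<rho> borel snd) F = emeasure P ((snd \<circ> T) -` F \<inter> space P)"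
      by (simp add: emeasure_distr)
    also have "(snd \<circ> T) -` F \<inter> space P = (sw -` (W \<inter> Q) \<inter> space P) \<union> (Q - W)"
      by (rule set_eqI) (simp add: spaceP TQ swW conj_commute)
    also have "emeasure P \<dots> = emeasure P (sw -` (W \<inter> Q) \<inter> space P) + emeasure P (Q - W)"
    proof (rule plus_emeasure[symmetric])
      show "sw -` (W \<inter> Q) \<inter> space P \<inter> (Q - W) = {}"
        by (rule set_eqI) (simp add: swW)
    qed (use sw W Q in \<open>auto intro: measurable_sets\<close>)
    also have "emeasure P (sw -` (W \<inter> Q) \<inter> space P) = emeasure (distr P P sw) (W \<inter> Q)"
      using sw W Q by (subst emeasure_distr) auto
    also have "\<dots> + emeasure P (Q - W) = emeasure P Q"
      unfolding dsw using W Q by (subst plus_emeasure) (auto simp: Int_Diff_Un Int_commute)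
    also have "\<dots> = emeasure (distr P borel (snd \<circ> fst)) F"
      using Pm(2) by (simp add: emeasure_distr Qeq comp_def)
    also have "distr P borel (snd \<circ> fst) = \<nu>"
      using distr_distr[OF s Pf(1)] dfst nu by simp
    finally show "emeasure (distr \<rho> borel snd) F = emeasure \<nu> F" .
  qed
  have "prob_space \<rho>" unfolding \<rho>_def by (rule P.prob_space_distr) measurable
  then have "\<rho> \<in> couplings \<mu> \<nu>"
    using \<rho>1 \<rho>2 by (simp add: couplings_def borel_prob_measures_def \<rho>_def)
  then have le: "plan_cost c \<pi> \<le> plan_cost c \<rho>"
    unfolding cost transport_cost_def by (rule INF_lower)
  have c\<rho>: "plan_cost c \<rho> = (\<integral>\<^sup>+p. ennreal (c (T p)) \<partial>P)"
    unfolding plan_cost_def \<rho>_def by (subst nn_integral_distr) (use T cb in auto)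
  have c\<pi>: "plan_cost c \<pi> = (\<integral>\<^sup>+p. ennreal (c (fst p)) \<partial>P)"
    unfolding plan_cost_def by (subst dfst[symmetric], subst nn_integral_distr) (use Pf(1) c in auto)
  have swap: "(\<integral>\<^sup>+p. f (sw p) \<partial>P) = (\<integral>\<^sup>+p. f p \<partial>P)" if "f \<in> borel_measurable P" for f :: "_ \<Rightarrow> ennreal"
    using that by (subst (2) dsw[symmetric]) (simp add: nn_integral_distr)
  have cT[measurable]: "(\<lambda>p. c (T p)) \<in> borel_measurable P" by (rule measurable_compose[OF T cb])
  \<comment> \<open>The exchange may raise the cost of one of the two pairs, but never their total.
    Adding both orders therefore makes the costs comparable pointwise, and the integrals are twice
    the plan costs.\<close>
  let ?f = "\<lambda>p. ennreal (c (T p)) + ennreal (c (T (sw p)))"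
  let ?g = "\<lambda>p. ennreal (c (fst p)) + ennreal (c (snd p))"
  have [measurable]: "(\<lambda>p. c (T (sw p))) \<in> borel_measurable P" by (rule measurable_compose[OF sw cT])
  have f2: "(\<integral>\<^sup>+p. ?f p \<partial>P) = plan_cost c \<rho> + plan_cost c \<rho>"
    using swap[of "\<lambda>p. ennreal (c (T p))"] by (simp add: nn_integral_add c\<rho>)
  have g2: "(\<integral>\<^sup>+p. ?g p \<partial>P) = plan_cost c \<pi> + plan_cost c \<pi>"
    using swap[of "\<lambda>p. ennreal (c (fst p))"] by (simp add: nn_integral_add c\<pi> sw_def)
  have fg: "c (T p) + c (T (sw p)) = c (fst p) + c (snd p) - max 0 (gap p)" for p
    by (cases "p \<in> W") (auto simp: T_def swW, auto simp: sw_def W_def gap_def max_def)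
  have fle: "?f p \<le> ?g p" for p
    using fg[of p] nonneg by (simp flip: ennreal_plus)
  have fless: "\<not> ?g p \<le> ?f p" if "p \<in> W" for p
  proof -
    have "c (T p) + c (T (sw p)) < c (fst p) + c (snd p)" using fg[of p] that by (simp add: W_def)
    then show ?thesis using nonneg by (simp flip: ennreal_plus add: not_le ennreal_less_iff)
  qed
  \<comment> \<open>A product neighbourhood of the violating pair fits into \<open>W\<close> and has
    positive mass, both points being in the support.\<close>
  have "open W"
    unfolding W_def gap_def
    by (intro open_Collect_less continuous_intros continuous_on_compose2[OF cont]) auto
  moreover have "((x, y), (x', y')) \<in> W" using neg by (simp add: W_def gap_def)
  ultimately obtain A B where AB: "open A" "open B" "(x, y) \<in> A" "(x', y') \<in> B" "A \<times> B \<subseteq> W"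
    by (metis mem_Sigma_iff open_prod_elim)
  have "0 < emeasure \<pi> A * emeasure \<pi> B"
    using msupp_emeasure_open_pos[OF supp(1) AB(1,3)] msupp_emeasure_open_pos[OF supp(2) AB(2,4)]
    by (simp add: ennreal_zero_less_mult_iff)
  also have "\<dots> = emeasure P (A \<times> B)"
    unfolding P_def using AB by (intro N.emeasure_pair_measure_Times[symmetric]) (auto simp: sets)
  also have "\<dots> \<le> emeasure P W" using AB(5) by (intro emeasure_mono) auto
  finally have "\<not> (AE p in P. p \<notin> W)"
    using AE_iff_measurable[of W P "\<lambda>p. p \<notin> W"] by (auto simp: spaceP)
  then have "\<not> (AE p in P. ?g p \<le> ?f p)"
    using fless by (metis (mono_tags, lifting) eventually_mono)
  \<comment> \<open>Finiteness lets strictness on a set of positive mass pass to the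
    integrals.\<close>
  moreover have "plan_cost c \<pi> < \<infinity>" using cost fin by simp
  then have "plan_cost c \<rho> + plan_cost c \<rho> < \<infinity>"
    using f2 g2 nn_integral_mono[of P ?f ?g] fle by (auto simp: less_top[symmetric] top_unique)
  ultimately have "(\<integral>\<^sup>+p. ?f p \<partial>P) < (\<integral>\<^sup>+p. ?g p \<partial>P)"
    using fle f2 by (intro nn_integral_less) auto
  then have "plan_cost c \<rho> + plan_cost c \<rho> < plan_cost c \<pi> + plan_cost c \<pi>"
    using f2 g2 by simp
  moreover have "plan_cost c \<pi> + plan_cost c \<pi> \<le> plan_cost c \<rho> + plan_cost c \<rho>"
    using le by (intro add_mono)
  ultimately show False by simp
qed

subsection \<open>Regularity in the interior of the support\<close>

theorem theorem5:
  fixes c :: "'a::complete_space \<times> 'a \<Rightarrow> real"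
    and h :: "real \<Rightarrow> real"
    and \<mu> \<nu> :: "'a measure"
    and \<pi> :: "('a \<times> 'a) measure"
  assumes "locally compact (UNIV :: 'a set)"
    and "geodesic_space (UNIV :: 'a set)"
    and "\<And>x y. c (x, y) = h (dist x y)"
    and "\<And>a. a \<ge> 0 \<Longrightarrow> h a \<ge> 0"
    and "locally_lipschitz_on {0..} h"
    and "filterlim (deriv h) at_top (inf at_top (principal {a. h differentiable (at a)}))"
    and "\<mu> \<in> borel_prob_measures" and "\<nu> \<in> borel_prob_measures"
    and "transport_cost c \<mu> \<nu> < \<infinity>"
    and "optimal_plan c \<mu> \<nu> \<pi>"
  shows "singular_points \<mu> \<nu> \<pi> \<subseteq> frontier (msupp \<mu>)"
proof
  note lc = assms(1) and geo = assms(2) and c = assms(3) and h0 = assms(4) and lip = assms(5)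
    and lim = assms(6) and fin = assms(9) and opt = assms(10)
  note cpt = hopf_rinow_compact_cball[OF lc geo]
  obtain B :: "'a set set" where B: "countable B" "topological_basis B"
    using compact_cball_countable_basis[OF cpt] by blast
  note prod = sets_borel_prod_countable_basis[OF B B]
  have BB: "countable ((\<lambda>(a, b). a \<times> b) ` (B \<times> B))" "topological_basis ((\<lambda>(a, b). a \<times> b) ` (B \<times> B))"
    using B(1) topological_basis_prod[OF B(2) B(2)] by auto
  have sets: "sets \<pi> = sets borel" and mu: "distr \<pi> borel fst = \<mu>" and nu: "distr \<pi> borel snd = \<nu>"
    using opt by (auto simp: optimal_plan_def couplings_def borel_prob_measures_def)
  have null: "emeasure \<pi> (- msupp \<pi>) = 0"
    by (rule emeasure_Compl_msupp_countable_basis[OF BB sets])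
  have conth: "continuous_on {0..} h" by (rule locally_lipschitz_on_imp_continuous_on[OF lip])
  have c_eq: "c = (\<lambda>z. h (dist (fst z) (snd z)))" using c by auto
  have contc: "continuous_on UNIV c"
    unfolding c_eq by (intro continuous_on_compose2[OF conth] continuous_intros) auto
  have cm: "h (dist x y) + h (dist x' y') \<le> h (dist x y') + h (dist x' y)"
    if "(x, y) \<in> msupp \<pi>" "(x', y') \<in> msupp \<pi>" for x y x' y'
    using optimal_plan_pairwise_monotone[OF contc _ prod opt fin that] h0 by (simp add: c_eq)
  \<comment> \<open>This gives density of the projected support in \<open>msupp \<mu>\<close>; hence
    the choice of points \<open>p z\<close> merely near \<open>z\<close> below.\<close>
  have proj: "\<exists>p q. (p, q) \<in> msupp \<pi> \<and> p \<in> V" if "x \<in> msupp \<mu>" "open V" "x \<in> V" for x V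
  proof (rule ccontr)
    assume "\<not> ?thesis"
    then have sub: "fst -` V \<subseteq> - msupp \<pi>" by auto
    have "fst \<in> \<pi> \<rightarrow>\<^sub>M borel"
      by (simp add: measurable_cong_sets[OF sets refl] borel_measurable_continuous_onI continuous_on_fst continuous_on_id)
    then have "emeasure \<mu> V = emeasure \<pi> (fst -` V)"
      using that(2) sets_eq_imp_space_eq[OF sets] by (simp add: mu[symmetric] emeasure_distr)
    also have "\<dots> \<le> emeasure \<pi> (- msupp \<pi>)"
      using sub sets closed_msupp[of \<pi>] by (intro emeasure_mono) auto
    finally show False using msupp_emeasure_open_pos[OF that] null by simp
  qed
  have supp_nu: "y \<in> msupp \<nu>" if "(x, y) \<in> msupp \<pi>" for x y
  proof (rule ccontr)
    assume "y \<notin> msupp \<nu>"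
    then obtain C where C: "closed C" "emeasure \<nu> (- C) = 0" "y \<notin> C" by (auto simp: msupp_def)
    have "snd \<in> \<pi> \<rightarrow>\<^sub>M borel"
      by (simp add: measurable_cong_sets[OF sets refl] borel_measurable_continuous_onI continuous_on_snd continuous_on_id)
    then have "emeasure \<pi> (snd -` (- C)) = 0"
      using C(1,2) sets_eq_imp_space_eq[OF sets] by (simp add: nu[symmetric] emeasure_distr)
    moreover have "open (snd -` (- C))" using C(1) by (intro open_vimage_snd) auto
    ultimately show False using msupp_emeasure_open_pos[OF that] C(3) by fastforce
  qed
  fix x0 assume x0: "x0 \<in> singular_points \<mu> \<nu> \<pi>"
  show "x0 \<in> frontier (msupp \<mu>)"
  proof (rule ccontr)
    assume "x0 \<notin> frontier (msupp \<mu>)"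
    moreover have x0m: "x0 \<in> msupp \<mu>" using x0 by (simp add: singular_points_def)
    ultimately have "x0 \<in> interior (msupp \<mu>)"
      using closure_subset by (auto simp: frontier_def)
    then obtain r where r: "r > 0" "cball x0 r \<subseteq> msupp \<mu>" by (meson mem_interior_cball)
    have "\<exists>p q. (p, q) \<in> msupp \<pi> \<and> dist z p < r / 8" if "z \<in> cball x0 r" for z
      using proj[of z "ball z (r / 8)"] r that by auto
    then obtain p q where pq: "\<And>z. z \<in> cball x0 r \<Longrightarrow> (p z, q z) \<in> msupp \<pi> \<and> dist z (p z) < r / 8"
      by metis
    have "cball x0 r \<subseteq> (\<Union>z\<in>cball x0 r. ball (p z) (r / 8))"
      using pq by (fastforce simp: dist_commute)
    from compactE_image[OF cpt _ this] obtain Z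
      where Z: "Z \<subseteq> cball x0 r" "finite Z" "cball x0 r \<subseteq> (\<Union>z\<in>Z. ball (p z) (r / 8))" by auto
    \<comment> \<open>A sum bounds all the finitely many distances at once; the summand
      \<open>r\<close> covers the step from \<open>x0\<close> to a nearby \<open>x\<close>.\<close>
    define R where "R = (\<Sum>z\<in>Z. dist x0 (q z)) + r"
    have R: "dist x0 (q z) + r \<le> R" if "z \<in> Z" for z
      unfolding R_def using member_le_sum[of z Z "\<lambda>z. dist x0 (q z)"] that Z(2) by simp
    have "compact (h ` {0..R})"
      by (intro compact_continuous_image continuous_on_subset[OF conth]) auto
    then obtain H where H: "\<And>a. 0 \<le> a \<Longrightarrow> a \<le> R \<Longrightarrow> h a \<le> H"
      using bounded_imp_bdd_above[OF compact_imp_bounded] by (fastforce simp: bdd_above_def)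
    \<comment> \<open>With this slope, \<open>h\<close> grows over a length \<open>r / 4\<close> by
      at least \<open>\<bar>H\<bar> + 1\<close>, which exceeds the bound \<open>H\<close>.\<close>
    define K where "K = 4 * (\<bar>H\<bar> + 1) / r"
    have K: "K > 0" using r by (simp add: K_def)
    have "eventually (\<lambda>a. K \<le> deriv h a) (inf at_top (principal {a. h differentiable (at a)}))"
      using lim by (simp add: filterlim_at_top)
    then obtain A0 where A0: "\<And>a. A0 \<le> a \<Longrightarrow> h differentiable (at a) \<Longrightarrow> K \<le> deriv h a"
      by (auto simp: eventually_inf_principal eventually_at_top_linorder)
    \<comment> \<open>The increment estimate must start at a nonnegative point.\<close>
    define A where "A = max A0 0"
    have incr: "K * (t - s) \<le> h t - h s" if "A \<le> s" "s \<le> t" for s t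
      using locally_lipschitz_increment_ge[OF lip, of A K s t] A0 that by (auto simp: A_def)
    have bound: "dist x y < A + r" if x: "dist x0 x < r / 2" and xy: "(x, y) \<in> msupp \<pi>" for x y
    proof (rule ccontr)
      assume "\<not> ?thesis"
      then have D: "A + r \<le> dist x y" by simp
      then have "0 \<le> r / 2" "r / 2 \<le> dist x y" using r by (auto simp: A_def)
      from geodesic_space_split[OF geo this] obtain w
        where w: "dist x w = r / 2" "dist w y = dist x y - r / 2" .
      have "w \<in> cball x0 r" using dist_triangle[of x0 w x] x w by simp
      then obtain z where z: "z \<in> Z" "dist (p z) w < r / 8" using Z(3) by auto
      have supp: "(p z, q z) \<in> msupp \<pi>" using pq z(1) Z(1) by auto
      \<comment> \<open>Replacing \<open>w\<close> by \<open>p z\<close> costs at most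
        \<open>r / 8\<close> of the gain \<open>r / 2\<close>. The same error keeps
        \<open>dist (p z) y\<close> above \<open>A\<close>, where the slope bound holds.\<close>
      have up: "dist (p z) y \<le> dist x y - r / 4"
        using dist_triangle[of "p z" y w] z(2) w r by linarith
      have lo: "A \<le> dist (p z) y"
        using dist_triangle[of w y "p z"] z(2) w D r by (simp add: dist_commute)
      have "dist x (q z) \<le> R"
        using R[OF z(1)] dist_triangle[of x "q z" x0] x r by (simp add: dist_commute)
      then have "h (dist x (q z)) \<le> H" by (intro H) auto
      moreover have "0 \<le> h (dist (p z) (q z))" by (rule h0) simp
      moreover have "K * (dist x y - dist (p z) y) \<le> h (dist x y) - h (dist (p z) y)"
        using up r by (intro incr[OF lo]) linarith
      moreover have "K * (r / 4) \<le> K * (dist x y - dist (p z) y)"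
        using up K by (intro mult_left_mono) auto
      moreover have "K * (r / 4) = \<bar>H\<bar> + 1" using r by (simp add: K_def)
      ultimately show False using cm[OF xy supp] by linarith
    qed
    define U where "U = ball x0 (r / 2) \<inter> msupp \<mu>"
    \<comment> \<open>Partners of points of \<open>U\<close> lie within
      \<open>(A + r) + r / 2\<close> of \<open>x0\<close>, so \<open>C\<close> contains them
      all.\<close>
    define C where "C = cball x0 (A + 2 * r) \<inter> msupp \<nu>"
    have "y \<in> C" if "(x, y) \<in> msupp \<pi>" "x \<in> U" for x y
      using r(1) bound[of x y] that supp_nu[of x y] dist_triangle[of x0 y x] by (auto simp: U_def C_def)
    then have "fst ` msupp \<pi> \<inter> U = fst ` (msupp \<pi> \<inter> (U \<times> C))" by force
    moreover have "compact C" unfolding C_def using cpt closed_msupp by (rule compact_Int_closed)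
    moreover have "openin (top_of_set (msupp \<mu>)) U"
      unfolding U_def by (simp add: openin_open_Int inf_commute[of "ball x0 (r / 2)"])
    ultimately have "induces_regularity_on \<mu> \<nu> \<pi> U"
      unfolding induces_regularity_on_def by (auto simp: C_def)
    moreover have "x0 \<in> U" using r x0m by (simp add: U_def)
    ultimately show False using x0 by (auto simp: singular_points_def induces_regularity_at_def)
  qed
qed

end
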